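(* Let $\lambda=m\varpi_1+n\varpi_2+k\varpi_3$ and $\mu=c_1\varpi_1+c_2\varpi_2+c_3\varpi_3$ with $m,n,k,c_1,c_2,c_3\in\mathbb{N}$. Put $x=\frac{3m+2n+k-3c_1-2c_2-c_3}{4}$, $y=\frac{m+2n+k-c_1-2c_2-c_3}{2}$, $z=\frac{m+2n+3k-c_1-2c_2-3c_3}{4}$, and $P_1=x$, $P_3=-c_1-c_2-y+z-2$, $P_4=-c_1-x+y-1$, $Q_1=y$, $Q_4=-c_1-c_2-x+z-2$, $Q_5=-c_2-c_3+x-z-2$, $Q_6=-c_2+x-y+z-1$, $R_1=z$, $R_3=-c_2-c_3+x-y-2$, $R_4=-c_3+y-z-1$. Define $Z_1=\wp_q(P_1\alpha_1+Q_1\alpha_2+R_1\alpha_3)$, $Z_2=\wp_q(P_3\alpha_1+Q_4\alpha_2+R_1\alpha_3)$, $Z_3=\wp_q(P_1\alpha_1+Q_1\alpha_2+R_4\alpha_3)$, $Z_4=\wp_q(P_3\alpha_1+Q_6\alpha_2+R_1\alpha_3)$, $Z_5=\wp_q(P_1\alpha_1+Q_5\alpha_2+R_4\alpha_3)$, $Z_6=\wp_q(P_4\alpha_1+Q_1\alpha_2+R_1\alpha_3)$, $Z_7=\wp_q(P_1\alpha_1+Q_5\alpha_2+R_3\alpha_3)$, $Z_8=\wp_q(P_4\alpha_1+Q_4\alpha_2+R_1\alpha_3)$, $Z_9=\wp_q(P_4\alpha_1+Q_1\alpha_2+R_4\alpha_3)$, $Z_{10}=\wp_q(P_1\alpha_1+Q_6\alpha_2+R_3\alpha_3)$,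 $Z_{11}=\wp_q(P_1\alpha_1+Q_6\alpha_2+R_1\alpha_3)$. Then $m_q(\lambda,\mu)$ equals: \begin{itemize} \item $Z_1-Z_{11}-Z_3+Z_5+Z_{10}-Z_7$ if $P_1,Q_1,R_1,Q_6,R_4,Q_5,R_3\in\mathbb{N}$ and $P_4,P_3\notin\mathbb{N}$; \item $Z_1-Z_6-Z_3+Z_4+Z_8-Z_2$ if $P_1,Q_1,R_1,P_4,Q_6,P_3,Q_4\in\mathbb{N}$ and $R_4,R_3\notin\mathbb{N}$; \item $Z_1-Z_6-Z_{11}-Z_3+Z_8+Z_9$ if $P_1,Q_1,R_1,P_4,R_4,Q_6,Q_4\in\mathbb{N}$ and $P_3,Q_5,R_3\notin\mathbb{N}$; \item $Z_1-Z_6-Z_{11}-Z_3+Z_9+Z_5$ if $P_1,Q_1,R_1,P_4,Q_6,R_4,Q_5\in\mathbb{N}$ and $P_3,Q_4,R_3\notin\mathbb{N}$; \item $Z_1-Z_6-Z_{11}-Z_3+Z_9$ if $P_1,Q_1,R_1,P_4,Q_6,R_4\in\mathbb{N}$ and $P_3,Q_4,Q_5,R_3\notin\mathbb{N}$; \item $Z_1-Z_{11}-Z_3+Z_5$ if $P_1,Q_1,R_1,Q_6,R_4,Q_5\in\mathbb{N}$ and $P_4,P_3,R_3\notin\mathbb{N}$; \item $Z_1-Z_6-Z_3+Z_9$ if $P_1,Q_1,R_1,P_4,R_4\in\mathbb{N}$ and $Q_6,Q_4,Q_5\notin\mathbb{N}$; \item $Z_1-Z_6-Z_{11}+Z_8$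 if $P_1,Q_1,R_1,P_4,Q_6,Q_4\in\mathbb{N}$ and $R_4,P_3,R_3\notin\mathbb{N}$; \item $Z_1-Z_{11}-Z_3$ if $P_1,Q_1,R_1,Q_6,R_4\in\mathbb{N}$ and $P_4,P_3,Q_5,R_3\notin\mathbb{N}$; \item $Z_1-Z_6-Z_{11}$ if $P_1,Q_1,R_1,P_4,Q_6\in\mathbb{N}$ and $R_4,P_3,Q_4,R_3\notin\mathbb{N}$; \item $Z_1-Z_3$ if $P_1,Q_1,R_1,R_4\in\mathbb{N}$, $Q_6,P_4,Q_5\notin\mathbb{N}$, and ($P_3\notin\mathbb{N}$ or $Q_4\notin\mathbb{N}$); \item $Z_1-Z_{11}$ if $P_1,Q_1,R_1,Q_6\in\mathbb{N}$ and $P_4,R_4,R_3,P_3\notin\mathbb{N}$; \item $Z_1-Z_6$ if $P_1,Q_1,R_1,P_4\in\mathbb{N}$, $Q_6,R_4,Q_4\notin\mathbb{N}$, and ($Q_5\notin\mathbb{N}$ or $R_3\notin\mathbb{N}$); \item $Z_1$ if $P_1,Q_1,R_1\in\mathbb{N}$, $R_4,P_4,Q_6\notin\mathbb{N}$, ($P_3\notin\mathbb{N}$ or $Q_4\notin\mathbb{N}$), and ($Q_5\notin\mathbb{N}$ or $R_3\notin\mathbb{N}$); \item $0$ otherwise. \end{itemize}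
   Context: Consider $\mathfrak{sl}_4(\mathbb{C})$ with simple roots $\alpha_1,\alpha_2,\alpha_3$ ($\alpha_i=e_i-e_{i+1}$ in $\mathbb{R}^4$), positive roots $\Phi^+=\{\alpha_1,\alpha_2,\alpha_3,\alpha_1+\alpha_2,\alpha_2+\alpha_3,\alpha_1+\alpha_2+\alpha_3\}$, fundamental weights $\varpi_1=\frac14(3\alpha_1+2\alpha_2+\alpha_3)$, $\varpi_2=\frac12(\alpha_1+2\alpha_2+\alpha_3)$, $\varpi_3=\frac14(\alpha_1+2\alpha_2+3\alpha_3)$, and $\rho=\varpi_1+\varpi_2+\varpi_3=\frac12(3\alpha_1+4\alpha_2+3\alpha_3)$. The Weyl group $W\cong\mathfrak{S}_4$ is generated by the reflections $s_1,s_2,s_3$, acting linearly with $s_i(\alpha_i)=-\alpha_i$, $s_i(\alpha_j)=\alpha_i+\alpha_j$ if $|i-j|=1$, $s_i(\alpha_j)=\alpha_j$ if $|i-j|>1$; $\ell(\sigma)$ is the minimal number of generators needed to write $\sigma$. For $\xi$ in the real span of the simple roots, $\wp_q(\xi)=\sum_{i\ge 0}c_iq^i$ where $c_i$ is the number of tuples $(a_\beta)_{\beta\in\Phi^+}\in\mathbb{N}^6$ with $\sum_\beta a_\beta\beta=\xi$ and $\sum_\beta a_\beta=i$ (so $\wp_q(\xi)=0$ if $\xi$ is not a nonnegative integral combination of positive roots). The $q$-analog of Kostant's weight multiplicity formula is $m_q(\lambda,\mu)=\sum_{\sigma\in W}(-1)^{\ell(\sigma)}\wp_q(\sigma(\lambda+\rho)-(\mu+\rho))$.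 Here $\mathbb{N}=\{0,1,2,\ldots\}$, and "$P\in\mathbb{N}$" means the (possibly non-integer) rational number $P$ is a nonnegative integer.
   Formalization: In the second case the formula is corrected to Z_1-Z_6-Z_{11}+Z_4+Z_8-Z_2 (Z_{11} in place of Z_3): there R_4 is not in N, so Z_3=0 while Z_{11} is nonzero, and the printed formula always fails, e.g. for λ=8ϖ_3, μ=0. *)

theory Defs
  imports "HOL-Analysis.Analysis" "HOL-Computational_Algebra.Polynomial"
begin

definition simple_root :: "nat \<Rightarrow> real ^ 4" ("\<alpha>") where
  "\<alpha> i = axis (of_nat i) 1 - axis (of_nat (Suc i)) 1"

definition positive_roots :: "(real ^ 4) set" ("\<Phi>\<^sup>+") where
  "\<Phi>\<^sup>+ = {\<alpha> 1, \<alpha> 2, \<alpha> 3, \<alpha> 1 + \<alpha> 2, \<alpha> 2 + \<alpha> 3, \<alpha> 1 + \<alpha> 2 + \<alpha> 3}"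

definition fund_weight1 :: "real ^ 4" ("\<omega>\<^sub>1") where
  "\<omega>\<^sub>1 = (1/4) *\<^sub>R (3 *\<^sub>R \<alpha> 1 + 2 *\<^sub>R \<alpha> 2 + \<alpha> 3)"

definition fund_weight2 :: "real ^ 4" ("\<omega>\<^sub>2") where
  "\<omega>\<^sub>2 = (1/2) *\<^sub>R (\<alpha> 1 + 2 *\<^sub>R \<alpha> 2 + \<alpha> 3)"

definition fund_weight3 :: "real ^ 4" ("\<omega>\<^sub>3") where
  "\<omega>\<^sub>3 = (1/4) *\<^sub>R (\<alpha> 1 + 2 *\<^sub>R \<alpha> 2 + 3 *\<^sub>R \<alpha> 3)"

definition weyl_vector :: "real ^ 4" ("\<rho>") where
  "\<rho> = \<omega>\<^sub>1 + \<omega>\<^sub>2 + \<omega>\<^sub>3"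

definition simple_reflection :: "nat \<Rightarrow> real ^ 4 \<Rightarrow> real ^ 4" where
  "simple_reflection i v = v - (2 * (v \<bullet> \<alpha> i) / (\<alpha> i \<bullet> \<alpha> i)) *\<^sub>R \<alpha> i"

definition reflection_word :: "nat list \<Rightarrow> real ^ 4 \<Rightarrow> real ^ 4" where
  "reflection_word w = foldr (\<lambda>i f. simple_reflection i \<circ> f) w id"

(* Words in the generators suffice, without inverses: simple reflections are involutions.
   The group acts on all of R^4, fixing (1,1,1,1), so a group element is determined by its
   restriction to the span of the simple roots. *)
definition weyl_group :: "(real ^ 4 \<Rightarrow> real ^ 4) set" where
  "weyl_group = reflection_word ` lists {1, 2, 3}"

definition weyl_length :: "(real ^ 4 \<Rightarrow> real ^ 4) \<Rightarrow> nat" ("\<ell>") where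
  "\<ell> \<sigma> = (LEAST r. \<exists>w \<in> lists {1, 2, 3}. length w = r \<and> reflection_word w = \<sigma>)"

definition kostant_partitions :: "real ^ 4 \<Rightarrow> nat \<Rightarrow> (real ^ 4 \<Rightarrow> nat) set" where
  "kostant_partitions \<xi> i =
     {a \<in> \<Phi>\<^sup>+ \<rightarrow>\<^sub>E UNIV. (\<Sum>\<beta>\<in>\<Phi>\<^sup>+. real (a \<beta>) *\<^sub>R \<beta>) = \<xi> \<and> (\<Sum>\<beta>\<in>\<Phi>\<^sup>+. a \<beta>) = i}"

(* Polynomials in q; the lemma coeff_kostant_q below shows that the argument of Abs_poly
   has finite support. *)
definition kostant_q :: "real ^ 4 \<Rightarrow> int poly" ("\<wp>\<^sub>q") where
  "\<wp>\<^sub>q \<xi> = Abs_poly (\<lambda>i. int (card (kostant_partitions \<xi> i)))"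

definition weight_multiplicity_q :: "real ^ 4 \<Rightarrow> real ^ 4 \<Rightarrow> int poly" ("m\<^sub>q") where
  "m\<^sub>q lam mu = (\<Sum>\<sigma>\<in>weyl_group. (-1) ^ \<ell> \<sigma> * \<wp>\<^sub>q (\<sigma> (lam + \<rho>) - (mu + \<rho>)))"

lemma simple_root_eq:
  "\<alpha> 1 = axis 1 1 - axis 2 1" "\<alpha> 2 = axis 2 1 - axis 3 1" "\<alpha> 3 = axis 3 1 - axis 4 1"
  by (simp_all add: simple_root_def)

lemma weyl_vector_eq: "\<rho> = (1/2) *\<^sub>R (3 *\<^sub>R \<alpha> 1 + 4 *\<^sub>R \<alpha> 2 + 3 *\<^sub>R \<alpha> 3)"
  by (simp add: weyl_vector_def fund_weight1_def fund_weight2_def fund_weight3_def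
      vec_eq_iff algebra_simps)

lemma linear_simple_reflection: "linear (simple_reflection i)"
  by (rule linearI)
    (simp_all add: simple_reflection_def inner_left_distrib algebra_simps add_divide_distrib)

lemma simple_reflection_simple_root:
  assumes "i \<in> {1, 2, 3}" "j \<in> {1, 2, 3}"
  shows "simple_reflection i (\<alpha> j) =
    (if i = j then - \<alpha> i else if \<bar>int i - int j\<bar> = 1 then \<alpha> i + \<alpha> j else \<alpha> j)"
  using assms
  by (auto simp: simple_reflection_def simple_root_def axis_def inner_vec_def
      sum_4 vec_eq_iff forall_4)

lemma coeff_kostant_q: "coeff (\<wp>\<^sub>q \<xi>) i = int (card (kostant_partitions \<xi> i))"
proof -
  have root: "1 \<le> \<beta> \<bullet> \<rho>" if "\<beta> \<in> \<Phi>\<^sup>+" for \<beta>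
    using that
    by (auto simp: positive_roots_def simple_root_def axis_def weyl_vector_eq inner_vec_def sum_4)
  have bound: "real j \<le> \<xi> \<bullet> \<rho>" if ne: "kostant_partitions \<xi> j \<noteq> {}" for j
  proof -
    obtain a where a: "(\<Sum>\<beta>\<in>\<Phi>\<^sup>+. real (a \<beta>) *\<^sub>R \<beta>) = \<xi>" "(\<Sum>\<beta>\<in>\<Phi>\<^sup>+. a \<beta>) = j"
      using ne by (auto simp: kostant_partitions_def)
    have "real j = (\<Sum>\<beta>\<in>\<Phi>\<^sup>+. real (a \<beta>))"
      using a(2) by auto
    also have "\<dots> \<le> (\<Sum>\<beta>\<in>\<Phi>\<^sup>+. real (a \<beta>) * (\<beta> \<bullet> \<rho>))"
      by (rule sum_mono) (use root in \<open>simp add: mult_le_cancel_left1\<close>)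
    also have "\<dots> = \<xi> \<bullet> \<rho>"
      unfolding a(1)[symmetric] by (simp add: inner_sum_left)
    finally show ?thesis .
  qed
  have "\<forall>\<^sub>\<infinity> j. int (card (kostant_partitions \<xi> j)) = 0"
    unfolding MOST_nat
  proof (intro exI allI impI)
    fix j assume j: "nat \<lceil>\<xi> \<bullet> \<rho>\<rceil> < j"
    have "kostant_partitions \<xi> j = {}"
    proof (rule ccontr)
      assume "kostant_partitions \<xi> j \<noteq> {}"
      from bound[OF this] j show False by linarith
    qed
    then show "int (card (kostant_partitions \<xi> j)) = 0" by simp
  qed
  then show ?thesis
    by (simp add: kostant_q_def Abs_poly_inverse)
qed

end

theory Submission
  imports Defs
begin

text \<open>
  The Weyl group acts on coordinates as all of S_4, with sign the parity of the length, so
  with L = \<open>\<lambda> + \<rho>\<close> and U = \<open>\<mu> + \<rho>\<close> each of the 24 terms is, up to sign, the partition function at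
  (L_a - U_1) \<open>\<alpha>\<^sub>1\<close> + (L_a + L_b - U_1 - U_2) \<open>\<alpha>\<^sub>2\<close> + (U_4 - L_d) \<open>\<alpha>\<^sub>3\<close>, where a, b, c, d are the
  images of 1, 2, 3, 4. Since L and U are strictly decreasing with coordinate sum 0, such a term is 0 if
  a = 4, d = 1, or {a, b} is {2, 4} or {3, 4}; one further term, (a, b, c, d) = (3, 1, 4, 2), is 0
  because L_3 \<open>\<ge>\<close> U_1 and L_2 \<open>\<le>\<close> U_4 cannot both hold. This leaves Z1, ..., Z11, and the case
  distinction only records which of these can be nonzero. It is a propositional consequence of the
  chains P1 > P4 > P3, R1 > R4 > R3, Q1 > Q6 > Q4, Q5, whose steps are integers, and of five
  further relations between the integrality conditions.
\<close>

section \<open>The Weyl group as the group of coordinate permutations\<close>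

definition permute_coords :: "('n \<Rightarrow> 'n) \<Rightarrow> real ^ 'n \<Rightarrow> real ^ 'n" where
  "permute_coords p v = (\<chi> j. v $ p j)"

lemma permute_coords_nth [simp]: "permute_coords p v $ j = v $ p j"
  by (simp add: permute_coords_def)

lemma permute_coords_id: "permute_coords id = id"
  by (simp add: fun_eq_iff vec_eq_iff)

text \<open>Coordinates are pulled back along the permutation, so the order of composition is
  reversed.\<close>

lemma permute_coords_comp: "permute_coords (p \<circ> q) = permute_coords q \<circ> permute_coords p"
  by (simp add: fun_eq_iff vec_eq_iff)

text \<open>Makes the sign a function of the group element and allows sums over the group to be
  reindexed by permutations.\<close>

lemma inj_permute_coords: "inj (permute_coords :: ('n::finite \<Rightarrow> 'n) \<Rightarrow> _)"
proof (rule injI)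
  fix p q :: "'n \<Rightarrow> 'n"
  assume eq: "permute_coords p = permute_coords q"
  have "p j = q j" for j
    \<comment> \<open>On this basis vector the left side has j-th coordinate 1, which the right side
      matches only if \<open>q j = p j\<close>.\<close>
    using arg_cong[OF eq, of "\<lambda>f. f (axis (p j) 1) $ j"] by (simp add: axis_def split: if_splits)
  then show "p = q" ..
qed

lemma simple_reflection_eq_permute_coords:
  assumes "i \<in> {1, 2, 3}"
  shows "simple_reflection i = permute_coords (Transposition.transpose (of_nat i) (of_nat (Suc i)))"
  using assms
  by (auto simp: fun_eq_iff simple_reflection_def simple_root_def axis_def inner_vec_def
      sum_4 vec_eq_iff forall_4 Transposition.transpose_def; simp add: field_simps)

lemma reflection_word_Nil [simp]: "reflection_word [] = id"
  by (simp add: reflection_word_def)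

lemma reflection_word_Cons [simp]:
  "reflection_word (i # w) = simple_reflection i \<circ> reflection_word w"
  by (simp add: reflection_word_def)

lemma reflection_word_append:
  "reflection_word (v @ w) = reflection_word v \<circ> reflection_word w"
  by (induction v) (simp_all add: comp_assoc)

text \<open>Each generator swaps two adjacent coordinates and so contributes a factor -1. Hence all
  words for one group element have lengths of the same parity.\<close>

lemma reflection_word_eq_permute_coords:
  assumes "w \<in> lists {1, 2, 3}"
  shows "\<exists>p. p permutes UNIV \<and> reflection_word w = permute_coords p \<and> sign p = (-1) ^ length w"
  using assms
proof (induction rule: lists.induct)
  case Nil
  show ?case
    by (intro exI[of _ id] conjI permutes_id)
      (simp_all only: reflection_word_Nil permute_coords_id sign_id list.size power_0)
next
  case (Cons i w)
  then obtain p where p: "p permutes UNIV" "reflection_word w = permute_coords p"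
    "sign p = (-1) ^ length w"
    by blast
  let ?t = "Transposition.transpose (of_nat i) (of_nat (Suc i)) :: 4 \<Rightarrow> 4"
  \<comment> \<open>In the type \<open>4\<close> numerals are taken modulo 4; the two indices still
    differ, so the transposition is a genuine one, of sign -1.\<close>
  have ne: "(of_nat i :: 4) \<noteq> of_nat (Suc i)"
    using Cons.hyps(1) by auto
  have t: "?t permutes UNIV"
    by (simp add: permutes_swap_id)
  show ?case
  proof (intro exI conjI)
    show "p \<circ> ?t permutes UNIV"
      using t p(1) by (rule permutes_compose)
    show "reflection_word (i # w) = permute_coords (p \<circ> ?t)"
      unfolding permute_coords_comp reflection_word_Cons p(2)
        simple_reflection_eq_permute_coords[OF Cons.hyps(1)] ..
    have "permutation p"
      using p(1) by (auto simp: permutation_permutes)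
    then show "sign (p \<circ> ?t) = (-1) ^ length (i # w)"
      using p(3) ne by (simp add: sign_compose sign_swap_id permutation_swap_id del: of_nat_Suc)
  qed
qed

lemma weyl_group_comp:
  assumes "\<sigma> \<in> weyl_group" "\<tau> \<in> weyl_group"
  shows "\<sigma> \<circ> \<tau> \<in> weyl_group"
proof -
  obtain v w where "\<sigma> = reflection_word v" "v \<in> lists {1, 2, 3}"
    "\<tau> = reflection_word w" "w \<in> lists {1, 2, 3}"
    using assms unfolding weyl_group_def by (elim imageE)
  then have "\<sigma> \<circ> \<tau> = reflection_word (v @ w)" "v @ w \<in> lists {1, 2, 3}"
    by (simp_all only: reflection_word_append append_in_lists_conv)
  then show ?thesis
    unfolding weyl_group_def by (rule image_eqI)
qed

text \<open>Only adjacent transpositions are generators; the other three arise from them by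
  conjugation. Induction over permutations will need all of them.\<close>

lemma permute_coords_transpose_in_weyl_group:
  "permute_coords (Transposition.transpose a b :: 4 \<Rightarrow> 4) \<in> weyl_group"
proof -
  let ?W = "\<lambda>p. permute_coords (p :: 4 \<Rightarrow> 4) \<in> weyl_group"
  have comp: "?W (p \<circ> q)" if "?W p" "?W q" for p q
    using that by (simp add: permute_coords_comp weyl_group_comp)
  have id: "?W id"
    unfolding weyl_group_def permute_coords_id
    by (rule image_eqI[where x = "[]"]) auto
  have s: "?W (Transposition.transpose (of_nat i) (of_nat (Suc i)))" if "i \<in> {1, 2, 3}" for i
    unfolding weyl_group_def simple_reflection_eq_permute_coords[OF that, symmetric]
    by (rule image_eqI[where x = "[i]"]) (use that in auto)
  have s12: "?W (Transposition.transpose 1 2)" and s23: "?W (Transposition.transpose 2 3)"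
    and s34: "?W (Transposition.transpose 3 4)"
    using s[of 1] s[of 2] s[of 3] by simp_all
  have "Transposition.transpose 1 3 =
      Transposition.transpose 1 2 \<circ> Transposition.transpose 2 3 \<circ> (Transposition.transpose 1 2 :: 4 \<Rightarrow> 4)"
    "Transposition.transpose 2 4 =
      Transposition.transpose 2 3 \<circ> Transposition.transpose 3 4 \<circ> (Transposition.transpose 2 3 :: 4 \<Rightarrow> 4)"
    "Transposition.transpose 1 4 =
      Transposition.transpose 1 2 \<circ> Transposition.transpose 2 4 \<circ> (Transposition.transpose 1 2 :: 4 \<Rightarrow> 4)"
    by (auto simp: fun_eq_iff forall_4 Transposition.transpose_def)
  then have s13: "?W (Transposition.transpose 1 3)" and s24: "?W (Transposition.transpose 2 4)"
    and s14: "?W (Transposition.transpose 1 4)"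
    using comp s12 s23 s34 by metis+
  show ?thesis
    using exhaust_4[of a] exhaust_4[of b] id s12 s23 s34 s13 s24 s14
    by (auto simp: Transposition.transpose_commute)
qed

lemma weyl_group_eq: "weyl_group = permute_coords ` {p :: 4 \<Rightarrow> 4. p permutes UNIV}"
proof
  show "weyl_group \<subseteq> permute_coords ` {p :: 4 \<Rightarrow> 4. p permutes UNIV}"
    unfolding weyl_group_def
    using reflection_word_eq_permute_coords by blast
  have "permute_coords p \<in> weyl_group" if "p permutes UNIV" for p :: "4 \<Rightarrow> 4"
    using finite that
  proof (induction rule: permutes_rev_induct)
    case id
    show ?case
      using permute_coords_transpose_in_weyl_group[of 1 1] by (simp only: transpose_same)
  next
    case (swap a b p)
    then show ?case
      unfolding permute_coords_comp
      by (intro weyl_group_comp permute_coords_transpose_in_weyl_group)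
  qed
  then show "permute_coords ` {p :: 4 \<Rightarrow> 4. p permutes UNIV} \<subseteq> weyl_group"
    by auto
qed

text \<open>The least length is attained by some word, whose parity gives the sign of its
  permutation; injectivity identifies that permutation with \<open>p\<close>.\<close>

lemma minus_one_power_weyl_length:
  assumes "p permutes UNIV"
  shows "(-1) ^ \<ell> (permute_coords p) = sign p"
proof -
  let ?len = "\<lambda>r. \<exists>w\<in>lists {1, 2, 3}. length w = r \<and> reflection_word w = permute_coords p"
  have "permute_coords p \<in> reflection_word ` lists {1, 2, 3}"
    using assms unfolding weyl_group_def[symmetric] weyl_group_eq by (intro imageI CollectI)
  then have "\<exists>r. ?len r"
    by (elim imageE) (rule exI, erule bexI[rotated], rule conjI[OF refl], erule sym)
  then have "?len (\<ell> (permute_coords p))"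
    unfolding weyl_length_def by (rule LeastI_ex)
  then obtain w where w: "w \<in> lists {1, 2, 3}" "length w = \<ell> (permute_coords p)"
    "reflection_word w = permute_coords p"
    by (elim bexE conjE)
  obtain q where "permute_coords p = permute_coords q" "sign q = (-1) ^ length w"
    using reflection_word_eq_permute_coords[OF w(1)] w(3) by auto
  then show ?thesis
    using w(2) injD[OF inj_permute_coords, of p q] by simp
qed

lemma weight_multiplicity_q_eq_sum_permutations:
  "m\<^sub>q lam mu = (\<Sum>p | p permutes UNIV.
     of_int (sign p) * \<wp>\<^sub>q (permute_coords p (lam + \<rho>) - (mu + \<rho>)))"
  unfolding weight_multiplicity_q_def weyl_group_eq
  by (subst sum.reindex[OF inj_on_subset[OF inj_permute_coords subset_UNIV]])
    (auto simp: minus_one_power_weyl_length[symmetric] intro!: sum.cong)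

section \<open>Vanishing of the partition function\<close>

lemma sum_in_Nats: "(\<And>x. x \<in> A \<Longrightarrow> f x \<in> \<nat>) \<Longrightarrow> sum f A \<in> \<nat>"
  by (induction A rule: infinite_finite_induct) auto

text \<open>The partial sums of the coordinates of a vector in the root span are its coefficients at
  the simple roots. For a positive root they are 0 or 1, so a vector with a Kostant partition has
  natural coefficients.\<close>

lemma kostant_q_simple_roots_eq_0:
  assumes "a \<notin> \<nat> \<or> b \<notin> \<nat> \<or> c \<notin> \<nat>"
  shows "\<wp>\<^sub>q (a *\<^sub>R \<alpha> 1 + b *\<^sub>R \<alpha> 2 + c *\<^sub>R \<alpha> 3) = 0" (is "\<wp>\<^sub>q ?\<xi> = 0")
proof (rule ccontr)
  assume "\<wp>\<^sub>q ?\<xi> \<noteq> 0"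
  then obtain i where "coeff (\<wp>\<^sub>q ?\<xi>) i \<noteq> 0"
    by (metis leading_coeff_0_iff)
  then obtain f where "f \<in> kostant_partitions ?\<xi> i"
    unfolding coeff_kostant_q by fastforce
  then have f: "?\<xi> = (\<Sum>\<beta>\<in>\<Phi>\<^sup>+. real (f \<beta>) *\<^sub>R \<beta>)"
    unfolding kostant_partitions_def by (elim CollectE conjE) (rule sym)
  have roots: "\<beta> $ 1 \<in> \<nat>" "\<beta> $ 1 + \<beta> $ 2 \<in> \<nat>" "\<beta> $ 1 + \<beta> $ 2 + \<beta> $ 3 \<in> \<nat>" if "\<beta> \<in> \<Phi>\<^sup>+" for \<beta>
    using that unfolding positive_roots_def simple_root_eq by (auto simp: axis_def)
  have "?\<xi> $ 1 = (\<Sum>\<beta>\<in>\<Phi>\<^sup>+. real (f \<beta>) * \<beta> $ 1)"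
    "?\<xi> $ 1 + ?\<xi> $ 2 = (\<Sum>\<beta>\<in>\<Phi>\<^sup>+. real (f \<beta>) * (\<beta> $ 1 + \<beta> $ 2))"
    "?\<xi> $ 1 + ?\<xi> $ 2 + ?\<xi> $ 3 = (\<Sum>\<beta>\<in>\<Phi>\<^sup>+. real (f \<beta>) * (\<beta> $ 1 + \<beta> $ 2 + \<beta> $ 3))"
    unfolding f by (simp_all add: distrib_left sum.distrib)
  then have "?\<xi> $ 1 \<in> \<nat>" "?\<xi> $ 1 + ?\<xi> $ 2 \<in> \<nat>" "?\<xi> $ 1 + ?\<xi> $ 2 + ?\<xi> $ 3 \<in> \<nat>"
    by (simp_all only: roots sum_in_Nats Nats_mult of_nat_in_Nats)
  then have "a \<in> \<nat>" "b \<in> \<nat>" "c \<in> \<nat>"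
    unfolding simple_root_eq by (simp_all add: axis_def)
  with assms show False by blast
qed

section \<open>Simple root coefficients and the signed sum over S_4\<close>

text \<open>The third coefficient is the partial sum of three coordinates, written through the
  fourth so that it involves only one image of the permutation.\<close>

lemma sum_zero_eq_simple_roots:
  assumes "v $ 1 + v $ 2 + v $ 3 + v $ 4 = 0"
  shows "v = v $ 1 *\<^sub>R \<alpha> 1 + (v $ 1 + v $ 2) *\<^sub>R \<alpha> 2 + (- v $ 4) *\<^sub>R \<alpha> 3"
  using assms unfolding simple_root_eq by (auto simp: axis_def vec_eq_iff forall_4)

text \<open>Recording a permutation by its four values turns the sum into explicit terms that the
  simplifier can recognise; the signs are those of the Leibniz formula.\<close>

lemma sum_permutations_4:
  fixes f :: "(4 \<Rightarrow> 4) \<Rightarrow> 'a::comm_ring_1" and g :: "4 \<Rightarrow> 4 \<Rightarrow> 4 \<Rightarrow> 4 \<Rightarrow> 'a"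
  assumes "\<And>p. p permutes UNIV \<Longrightarrow> f p = g (p 1) (p 2) (p 3) (p 4)"
  shows "(\<Sum>p | p permutes UNIV. of_int (sign p) * f p) =
    g 1 2 3 4 - g 1 2 4 3 - g 1 3 2 4 + g 1 3 4 2 + g 1 4 2 3 - g 1 4 3 2
  - g 2 1 3 4 + g 2 1 4 3 + g 2 3 1 4 - g 2 3 4 1 - g 2 4 1 3 + g 2 4 3 1
  + g 3 1 2 4 - g 3 1 4 2 - g 3 2 1 4 + g 3 2 4 1 + g 3 4 1 2 - g 3 4 2 1
  - g 4 1 2 3 + g 4 1 3 2 + g 4 2 1 3 - g 4 2 3 1 - g 4 3 1 2 + g 4 3 2 1"
proof -
  have f1234: "finite {2::4, 3, 4}" "1 \<notin> {2::4, 3, 4}"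
    and f234: "finite {3::4, 4}" "2 \<notin> {3::4, 4}"
    and f34: "finite {4::4}" "3 \<notin> {4::4}"
    by auto
  have "(\<Sum>p | p permutes UNIV. of_int (sign p) * f p) =
    (\<Sum>p | p permutes (UNIV :: 4 set). of_int (sign p) * g (p 1) (p 2) (p 3) (p 4))"
    using assms by (auto intro: sum.cong)
  also have "\<dots> =
    g 1 2 3 4 - g 1 2 4 3 - g 1 3 2 4 + g 1 3 4 2 + g 1 4 2 3 - g 1 4 3 2
  - g 2 1 3 4 + g 2 1 4 3 + g 2 3 1 4 - g 2 3 4 1 - g 2 4 1 3 + g 2 4 3 1
  + g 3 1 2 4 - g 3 1 4 2 - g 3 2 1 4 + g 3 2 4 1 + g 3 4 1 2 - g 3 4 2 1
  - g 4 1 2 3 + g 4 1 3 2 + g 4 2 1 3 - g 4 2 3 1 - g 4 3 1 2 + g 4 3 2 1"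
    \<comment> \<open>One point is peeled off at a time: a permutation of the larger set is a
      transposition moving that point, composed with a permutation of the rest.\<close>
    unfolding UNIV_4
    unfolding sum_over_permutations_insert[OF f1234]
    unfolding sum_over_permutations_insert[OF f234]
    unfolding sum_over_permutations_insert[OF f34]
    unfolding permutes_sing
    by (simp add: sign_swap_id permutation_swap_id permutation_compose sign_compose
        Transposition.transpose_def)
  finally show ?thesis .
qed

section \<open>Natural numbers among the reals, and the case distinction\<close>

lemma Nats_diff_real: "a \<in> \<nat> \<Longrightarrow> real j \<le> a \<Longrightarrow> a - real j \<in> \<nat>"
  by (auto elim!: Nats_cases simp flip: of_nat_diff)

lemma Nats_nonneg: "a \<in> \<nat> \<Longrightarrow> (0::real) \<le> a"
  by (auto elim: Nats_cases)

lemma Nats_add_real: "a - real j \<in> \<nat> \<Longrightarrow> a \<in> \<nat>"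
  using Nats_add[of "a - real j" "real j"] by simp

(* B1, ..., B14 are the case conditions in order. In the case B2 the source prints -Z3 where
   -Z11 stands here. Since R4 \<notin> \<nat> in that case, Z3 = 0 there, and the printed formula fails
   for example for m = n = 0, k = 8, c1 = c2 = c3 = 0. The case B2 below is the image of B1
   under exchanging \<alpha> 1 and \<alpha> 3. *)
theorem theorem3:
  fixes m n k c1 c2 c3 :: nat
    and lam mu :: "real ^ 4"
    and x y z P1 P3 P4 Q1 Q4 Q5 Q6 R1 R3 R4 :: real
    and Z1 Z2 Z3 Z4 Z5 Z6 Z7 Z8 Z9 Z10 Z11 :: "int poly"
    and B1 B2 B3 B4 B5 B6 B7 B8 B9 B10 B11 B12 B13 B14 :: bool
  assumes "lam = real m *\<^sub>R \<omega>\<^sub>1 + real n *\<^sub>R \<omega>\<^sub>2 + real k *\<^sub>R \<omega>\<^sub>3"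
    and "mu = real c1 *\<^sub>R \<omega>\<^sub>1 + real c2 *\<^sub>R \<omega>\<^sub>2 + real c3 *\<^sub>R \<omega>\<^sub>3"
    and "x = (3 * real m + 2 * real n + real k - 3 * real c1 - 2 * real c2 - real c3) / 4"
    and "y = (real m + 2 * real n + real k - real c1 - 2 * real c2 - real c3) / 2"
    and "z = (real m + 2 * real n + 3 * real k - real c1 - 2 * real c2 - 3 * real c3) / 4"
    and "P1 = x"
    and "P3 = - real c1 - real c2 - y + z - 2"
    and "P4 = - real c1 - x + y - 1"
    and "Q1 = y"
    and "Q4 = - real c1 - real c2 - x + z - 2"
    and "Q5 = - real c2 - real c3 + x - z - 2"
    and "Q6 = - real c2 + x - y + z - 1"
    and "R1 = z"
    and "R3 = - real c2 - real c3 + x - y - 2"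
    and "R4 = - real c3 + y - z - 1"
    and "Z1 = \<wp>\<^sub>q (P1 *\<^sub>R \<alpha> 1 + Q1 *\<^sub>R \<alpha> 2 + R1 *\<^sub>R \<alpha> 3)"
    and "Z2 = \<wp>\<^sub>q (P3 *\<^sub>R \<alpha> 1 + Q4 *\<^sub>R \<alpha> 2 + R1 *\<^sub>R \<alpha> 3)"
    and "Z3 = \<wp>\<^sub>q (P1 *\<^sub>R \<alpha> 1 + Q1 *\<^sub>R \<alpha> 2 + R4 *\<^sub>R \<alpha> 3)"
    and "Z4 = \<wp>\<^sub>q (P3 *\<^sub>R \<alpha> 1 + Q6 *\<^sub>R \<alpha> 2 + R1 *\<^sub>R \<alpha> 3)"
    and "Z5 = \<wp>\<^sub>q (P1 *\<^sub>R \<alpha> 1 + Q5 *\<^sub>R \<alpha> 2 + R4 *\<^sub>R \<alpha> 3)"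
    and "Z6 = \<wp>\<^sub>q (P4 *\<^sub>R \<alpha> 1 + Q1 *\<^sub>R \<alpha> 2 + R1 *\<^sub>R \<alpha> 3)"
    and "Z7 = \<wp>\<^sub>q (P1 *\<^sub>R \<alpha> 1 + Q5 *\<^sub>R \<alpha> 2 + R3 *\<^sub>R \<alpha> 3)"
    and "Z8 = \<wp>\<^sub>q (P4 *\<^sub>R \<alpha> 1 + Q4 *\<^sub>R \<alpha> 2 + R1 *\<^sub>R \<alpha> 3)"
    and "Z9 = \<wp>\<^sub>q (P4 *\<^sub>R \<alpha> 1 + Q1 *\<^sub>R \<alpha> 2 + R4 *\<^sub>R \<alpha> 3)"
    and "Z10 = \<wp>\<^sub>q (P1 *\<^sub>R \<alpha> 1 + Q6 *\<^sub>R \<alpha> 2 + R3 *\<^sub>R \<alpha> 3)"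
    and "Z11 = \<wp>\<^sub>q (P1 *\<^sub>R \<alpha> 1 + Q6 *\<^sub>R \<alpha> 2 + R1 *\<^sub>R \<alpha> 3)"
    and "B1 \<longleftrightarrow> {P1, Q1, R1, Q6, R4, Q5, R3} \<subseteq> \<nat> \<and> P4 \<notin> \<nat> \<and> P3 \<notin> \<nat>"
    and "B2 \<longleftrightarrow> {P1, Q1, R1, P4, Q6, P3, Q4} \<subseteq> \<nat> \<and> R4 \<notin> \<nat> \<and> R3 \<notin> \<nat>"
    and "B3 \<longleftrightarrow> {P1, Q1, R1, P4, R4, Q6, Q4} \<subseteq> \<nat> \<and> P3 \<notin> \<nat> \<and> Q5 \<notin> \<nat> \<and> R3 \<notin> \<nat>"
    and "B4 \<longleftrightarrow> {P1, Q1, R1, P4, Q6, R4, Q5} \<subseteq> \<nat> \<and> P3 \<notin> \<nat> \<and> Q4 \<notin> \<nat> \<and> R3 \<notin> \<nat>"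
    and "B5 \<longleftrightarrow> {P1, Q1, R1, P4, Q6, R4} \<subseteq> \<nat> \<and> P3 \<notin> \<nat> \<and> Q4 \<notin> \<nat> \<and> Q5 \<notin> \<nat> \<and> R3 \<notin> \<nat>"
    and "B6 \<longleftrightarrow> {P1, Q1, R1, Q6, R4, Q5} \<subseteq> \<nat> \<and> P4 \<notin> \<nat> \<and> P3 \<notin> \<nat> \<and> R3 \<notin> \<nat>"
    and "B7 \<longleftrightarrow> {P1, Q1, R1, P4, R4} \<subseteq> \<nat> \<and> Q6 \<notin> \<nat> \<and> Q4 \<notin> \<nat> \<and> Q5 \<notin> \<nat>"
    and "B8 \<longleftrightarrow> {P1, Q1, R1, P4, Q6, Q4} \<subseteq> \<nat> \<and> R4 \<notin> \<nat> \<and> P3 \<notin> \<nat> \<and> R3 \<notin> \<nat>"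
    and "B9 \<longleftrightarrow> {P1, Q1, R1, Q6, R4} \<subseteq> \<nat> \<and> P4 \<notin> \<nat> \<and> P3 \<notin> \<nat> \<and> Q5 \<notin> \<nat> \<and> R3 \<notin> \<nat>"
    and "B10 \<longleftrightarrow> {P1, Q1, R1, P4, Q6} \<subseteq> \<nat> \<and> R4 \<notin> \<nat> \<and> P3 \<notin> \<nat> \<and> Q4 \<notin> \<nat> \<and> R3 \<notin> \<nat>"
    and "B11 \<longleftrightarrow> {P1, Q1, R1, R4} \<subseteq> \<nat> \<and> Q6 \<notin> \<nat> \<and> P4 \<notin> \<nat> \<and> Q5 \<notin> \<nat>
           \<and> (P3 \<notin> \<nat> \<or> Q4 \<notin> \<nat>)"
    and "B12 \<longleftrightarrow> {P1, Q1, R1, Q6} \<subseteq> \<nat> \<and> P4 \<notin> \<nat> \<and> R4 \<notin> \<nat> \<and> R3 \<notin> \<nat> \<and> P3 \<notin> \<nat>"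
    and "B13 \<longleftrightarrow> {P1, Q1, R1, P4} \<subseteq> \<nat> \<and> Q6 \<notin> \<nat> \<and> R4 \<notin> \<nat> \<and> Q4 \<notin> \<nat>
           \<and> (Q5 \<notin> \<nat> \<or> R3 \<notin> \<nat>)"
    and "B14 \<longleftrightarrow> {P1, Q1, R1} \<subseteq> \<nat> \<and> R4 \<notin> \<nat> \<and> P4 \<notin> \<nat> \<and> Q6 \<notin> \<nat>
           \<and> (P3 \<notin> \<nat> \<or> Q4 \<notin> \<nat>) \<and> (Q5 \<notin> \<nat> \<or> R3 \<notin> \<nat>)"
  shows "(B1 \<longrightarrow> m\<^sub>q lam mu = Z1 - Z11 - Z3 + Z5 + Z10 - Z7)
    \<and> (B2 \<longrightarrow> m\<^sub>q lam mu = Z1 - Z6 - Z11 + Z4 + Z8 - Z2)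
    \<and> (B3 \<longrightarrow> m\<^sub>q lam mu = Z1 - Z6 - Z11 - Z3 + Z8 + Z9)
    \<and> (B4 \<longrightarrow> m\<^sub>q lam mu = Z1 - Z6 - Z11 - Z3 + Z9 + Z5)
    \<and> (B5 \<longrightarrow> m\<^sub>q lam mu = Z1 - Z6 - Z11 - Z3 + Z9)
    \<and> (B6 \<longrightarrow> m\<^sub>q lam mu = Z1 - Z11 - Z3 + Z5)
    \<and> (B7 \<longrightarrow> m\<^sub>q lam mu = Z1 - Z6 - Z3 + Z9)
    \<and> (B8 \<longrightarrow> m\<^sub>q lam mu = Z1 - Z6 - Z11 + Z8)
    \<and> (B9 \<longrightarrow> m\<^sub>q lam mu = Z1 - Z11 - Z3)
    \<and> (B10 \<longrightarrow> m\<^sub>q lam mu = Z1 - Z6 - Z11)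
    \<and> (B11 \<longrightarrow> m\<^sub>q lam mu = Z1 - Z3)
    \<and> (B12 \<longrightarrow> m\<^sub>q lam mu = Z1 - Z11)
    \<and> (B13 \<longrightarrow> m\<^sub>q lam mu = Z1 - Z6)
    \<and> (B14 \<longrightarrow> m\<^sub>q lam mu = Z1)
    \<and> (\<not> (B1 \<or> B2 \<or> B3 \<or> B4 \<or> B5 \<or> B6 \<or> B7 \<or> B8 \<or> B9 \<or> B10 \<or> B11 \<or> B12 \<or> B13 \<or> B14)
         \<longrightarrow> m\<^sub>q lam mu = 0)"
proof -
  define L where "L = lam + \<rho>"
  define U where "U = mu + \<rho>"
  define g where "g a b c d = \<wp>\<^sub>q ((L $ a - U $ 1) *\<^sub>R \<alpha> 1
    + (L $ a + L $ b - (U $ 1 + U $ 2)) *\<^sub>R \<alpha> 2 + (U $ 4 - L $ d) *\<^sub>R \<alpha> 3)" for a b c d :: 4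
  note weights = weyl_vector_eq fund_weight1_def fund_weight2_def fund_weight3_def simple_root_eq
  have L: "L $ 1 = (3 * real m + 2 * real n + real k + 6) / 4"
    "L $ 2 = (2 * real n + real k - real m + 2) / 4"
    "L $ 3 = (real k - 2 * real n - real m - 2) / 4"
    "L $ 4 = - (real m + 2 * real n + 3 * real k + 6) / 4"
    unfolding L_def assms(1) weights by (simp_all add: axis_def field_simps)
  have U: "U $ 1 = (3 * real c1 + 2 * real c2 + real c3 + 6) / 4"
    "U $ 2 = (2 * real c2 + real c3 - real c1 + 2) / 4"
    "U $ 3 = (real c3 - 2 * real c2 - real c1 - 2) / 4"
    "U $ 4 = - (real c1 + 2 * real c2 + 3 * real c3 + 6) / 4"
    unfolding U_def assms(2) weights by (simp_all add: axis_def field_simps)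
  note PQR = assms(3-15)
  \<comment> \<open>\<open>Q1\<close>, \<open>Q6\<close> and \<open>Q4\<close> occur for both orders
    of a and b; \<open>Q5\<close> needs one order only, since a = 4 gives 0.\<close>
  have coeffs: "L $ 1 - U $ 1 = P1" "L $ 2 - U $ 1 = P4" "L $ 3 - U $ 1 = P3"
    "L $ 1 + L $ 2 - (U $ 1 + U $ 2) = Q1" "L $ 2 + L $ 1 - (U $ 1 + U $ 2) = Q1"
    "L $ 1 + L $ 3 - (U $ 1 + U $ 2) = Q6" "L $ 3 + L $ 1 - (U $ 1 + U $ 2) = Q6"
    "L $ 2 + L $ 3 - (U $ 1 + U $ 2) = Q4" "L $ 3 + L $ 2 - (U $ 1 + U $ 2) = Q4"
    "L $ 1 + L $ 4 - (U $ 1 + U $ 2) = Q5"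
    "U $ 4 - L $ 4 = R1" "U $ 4 - L $ 3 = R4" "U $ 4 - L $ 2 = R3"
    unfolding PQR L U by (simp_all add: field_simps)

  have "\<wp>\<^sub>q (permute_coords p L - U) = g (p 1) (p 2) (p 3) (p 4)" if p: "p permutes UNIV" for p
  proof -
    have "(\<Sum>j\<in>UNIV. L $ p j) = (\<Sum>j\<in>UNIV. L $ j)"
      using sum.permute[OF p, of "\<lambda>j. L $ j"] by (simp add: comp_def)
    then have sum_L: "L $ p 1 + L $ p 2 + L $ p 3 + L $ p 4 = 0"
      unfolding sum_4 L by (simp add: field_simps)
    have sum_U: "U $ 1 + U $ 2 + U $ 3 + U $ 4 = 0"
      unfolding U by (simp add: field_simps)
    have "permute_coords p L - U = (L $ p 1 - U $ 1) *\<^sub>R \<alpha> 1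
      + (L $ p 1 + L $ p 2 - (U $ 1 + U $ 2)) *\<^sub>R \<alpha> 2 + (U $ 4 - L $ p 4) *\<^sub>R \<alpha> 3"
      using sum_zero_eq_simple_roots[of "permute_coords p L - U"] sum_L sum_U
      by (simp add: algebra_simps)
    then show ?thesis
      by (simp add: g_def)
  qed
  note expansion = sum_permutations_4[of "\<lambda>p. \<wp>\<^sub>q (permute_coords p L - U)" g, OF this]

  have g_zero: "g a b c d = 0"
    if "L $ a < U $ 1 \<or> L $ a + L $ b < U $ 1 + U $ 2 \<or> U $ 4 < L $ d" for a b c d
    unfolding g_def
    by (rule kostant_q_simple_roots_eq_0) (use that Nats_nonneg in \<open>force simp: not_le\<close>)
  have "g 4 b c d = 0" "g a b c 1 = 0" "g 2 4 c d = 0" "g 3 4 c d = 0" for a b c d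
    by (rule g_zero; simp add: L U field_simps)+
  \<comment> \<open>If L_3 \<ge> U_1, then L_2 > L_3 \<ge> U_1 > 0 > U_4 makes the third coefficient
    negative; otherwise the first one is.\<close>
  moreover have "U $ 4 < L $ 2" if "U $ 1 \<le> L $ 3"
    using that unfolding L U by (simp add: field_simps)
  then have "g 3 1 4 2 = 0"
    using g_zero[where a = 3 and b = 1 and c = 4 and d = 2] by force
  moreover have "g 1 2 3 4 = Z1" "g 1 2 4 3 = Z3" "g 2 1 3 4 = Z6" "g 2 1 4 3 = Z9"
    "g 1 3 2 4 = Z11" "g 1 3 4 2 = Z10" "g 3 1 2 4 = Z4" "g 1 4 2 3 = Z5" "g 1 4 3 2 = Z7"
    "g 2 3 1 4 = Z8" "g 3 2 1 4 = Z2"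
    unfolding g_def coeffs assms(16-26) by simp_all
  ultimately have mq: "m\<^sub>q lam mu = Z1 - Z3 - Z6 + Z9 - Z11 + Z10 + Z4 + Z5 - Z7 + Z8 - Z2"
    unfolding weight_multiplicity_q_eq_sum_permutations[of lam mu, folded L_def U_def]
    by (subst expansion) simp_all

  note vanish = kostant_q_simple_roots_eq_0
  have Z1: "P1 \<notin> \<nat> \<or> Q1 \<notin> \<nat> \<or> R1 \<notin> \<nat> \<Longrightarrow> Z1 = 0" unfolding assms(16) by (rule vanish)
  have Z2: "P3 \<notin> \<nat> \<or> Q4 \<notin> \<nat> \<or> R1 \<notin> \<nat> \<Longrightarrow> Z2 = 0" unfolding assms(17) by (rule vanish)
  have Z3: "P1 \<notin> \<nat> \<or> Q1 \<notin> \<nat> \<or> R4 \<notin> \<nat> \<Longrightarrow> Z3 = 0" unfolding assms(18) by (rule vanish)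
  have Z4: "P3 \<notin> \<nat> \<or> Q6 \<notin> \<nat> \<or> R1 \<notin> \<nat> \<Longrightarrow> Z4 = 0" unfolding assms(19) by (rule vanish)
  have Z5: "P1 \<notin> \<nat> \<or> Q5 \<notin> \<nat> \<or> R4 \<notin> \<nat> \<Longrightarrow> Z5 = 0" unfolding assms(20) by (rule vanish)
  have Z6: "P4 \<notin> \<nat> \<or> Q1 \<notin> \<nat> \<or> R1 \<notin> \<nat> \<Longrightarrow> Z6 = 0" unfolding assms(21) by (rule vanish)
  have Z7: "P1 \<notin> \<nat> \<or> Q5 \<notin> \<nat> \<or> R3 \<notin> \<nat> \<Longrightarrow> Z7 = 0" unfolding assms(22) by (rule vanish)
  have Z8: "P4 \<notin> \<nat> \<or> Q4 \<notin> \<nat> \<or> R1 \<notin> \<nat> \<Longrightarrow> Z8 = 0" unfolding assms(23) by (rule vanish)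
  have Z9: "P4 \<notin> \<nat> \<or> Q1 \<notin> \<nat> \<or> R4 \<notin> \<nat> \<Longrightarrow> Z9 = 0" unfolding assms(24) by (rule vanish)
  have Z10: "P1 \<notin> \<nat> \<or> Q6 \<notin> \<nat> \<or> R3 \<notin> \<nat> \<Longrightarrow> Z10 = 0" unfolding assms(25) by (rule vanish)
  have Z11: "P1 \<notin> \<nat> \<or> Q6 \<notin> \<nat> \<or> R1 \<notin> \<nat> \<Longrightarrow> Z11 = 0" unfolding assms(26) by (rule vanish)
  note Zs = Z1 Z2 Z3 Z4 Z5 Z6 Z7 Z8 Z9 Z10 Z11

  \<comment> \<open>The coordinates of \<open>U\<close> cancel, leaving the gaps m + 1, n + 1, k + 1
    between consecutive coordinates of \<open>L\<close>.\<close>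
  have steps: "P4 = P1 - real (m + 1)" "P3 = P4 - real (n + 1)"
    "R4 = R1 - real (k + 1)" "R3 = R4 - real (n + 1)" "Q6 = Q1 - real (n + 1)"
    "Q4 = Q6 - real (m + 1)" "Q5 = Q6 - real (k + 1)"
    unfolding PQR by (simp_all add: field_simps)
  have down: "P1 \<notin> \<nat> \<Longrightarrow> P4 \<notin> \<nat>" "P4 \<notin> \<nat> \<Longrightarrow> P3 \<notin> \<nat>" "R1 \<notin> \<nat> \<Longrightarrow> R4 \<notin> \<nat>"
    "R4 \<notin> \<nat> \<Longrightarrow> R3 \<notin> \<nat>" "Q1 \<notin> \<nat> \<Longrightarrow> Q6 \<notin> \<nat>" "Q6 \<notin> \<nat> \<Longrightarrow> Q4 \<notin> \<nat>" "Q6 \<notin> \<nat> \<Longrightarrow> Q5 \<notin> \<nat>"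
    using Nats_add_real steps by metis+
  \<comment> \<open>Each pair has a negative sum: P3 + R4 = P4 + R3 = U_4 - U_1 and Q4 + Q5 = -2
    (U_1 + U_2).\<close>
  have excl: "\<not> (P3 \<in> \<nat> \<and> R4 \<in> \<nat>)" "\<not> (R3 \<in> \<nat> \<and> P4 \<in> \<nat>)" "\<not> (Q4 \<in> \<nat> \<and> Q5 \<in> \<nat>)"
    by (auto dest!: Nats_nonneg simp: PQR field_simps)
  \<comment> \<open>The sign comes from Q4 - P3 = L_2 - U_2 and L_2 > L_3 \<ge> U_1 > U_2, the
    integrality from \<open>Q1\<close>. Exchanging \<alpha> 1 and \<alpha> 3 gives
    \<open>up'\<close>.\<close>
  have up: "Q4 \<in> \<nat>" if "P3 \<in> \<nat>" "Q1 \<in> \<nat>"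
  proof -
    have "Q4 = Q1 - real (m + n + 2)" "0 \<le> Q4"
      using Nats_nonneg[OF that(1)] unfolding PQR by (simp_all add: field_simps)
    then show ?thesis
      using Nats_diff_real[OF that(2), of "m + n + 2"] by simp
  qed
  have up': "Q5 \<in> \<nat>" if "R3 \<in> \<nat>" "Q1 \<in> \<nat>"
  proof -
    have "Q5 = Q1 - real (n + k + 2)" "0 \<le> Q5"
      using Nats_nonneg[OF that(1)] unfolding PQR by (simp_all add: field_simps)
    then show ?thesis
      using Nats_diff_real[OF that(2), of "n + k + 2"] by simp
  qed
  note B = assms(27-40)
  show ?thesis
  proof (intro conjI impI)
    assume "\<not> (B1 \<or> B2 \<or> B3 \<or> B4 \<or> B5 \<or> B6 \<or> B7 \<or> B8 \<or> B9 \<or> B10 \<or> B11 \<or> B12 \<or> B13 \<or> B14)"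
    then have "P1 \<notin> \<nat> \<or> Q1 \<notin> \<nat> \<or> R1 \<notin> \<nat>"
      unfolding B insert_subset using down excl up up' by (smt (verit) empty_subsetI)
    \<comment> \<open>Every Z takes one coefficient from each of the P, Q and R chains, so failure
      at the top of one chain kills all eleven terms.\<close>
    then show "m\<^sub>q lam mu = 0"
      unfolding mq by (elim disjE) (simp_all add: Zs down)
  \<comment> \<open>For every term that a case omits, its conditions already supply a coefficient
    outside \<nat>.\<close>
  qed (auto simp: B mq Zs)
qed

end
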